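(* Suppose there exists a repairable $(k,\ell_1,\ell_2)$-distribution design on $m$ points, having $n$ blocks of size $d$, and suppose that $Q$ is a prime power with $Q\ge m+1$. Then there is a $(k,n,d)$-RTS with restricted repairability, having information rate $(\ell_2-\ell_1)/d$ and communication complexity $d/(\ell_2-\ell_1)$, where every share is in $(\mathbb{F}_Q)^d$.
   Context: Distribution designs. A design consists of a finite set $X$ of $m$ points and a collection of blocks, each a $d$-element subset of $X$. For an integer $k\ge 2$ not exceeding the number of blocks, and integers $\ell_1,\ell_2$ with $\ell_2-\ell_1\ge 1$, it is a $(k,\ell_1,\ell_2)$-distribution design if the union of any $k$ blocks contains at least $\ell_2$ points and the union of any $k-1$ blocks contains at most $\ell_1$ points. It is repairable if every point occurs in at least two blocks. Threshold schemes. For $2\le k\le n$, a $(k,n)$-threshold scheme is a (randomized) method by which a dealer chooses a secret from a finite set $\mathcal{K}$ and gives a share, from a finite set $\mathcal{S}$ of possible shares, to each of $n$ players $P_1,\dots,P_n$, such that any $k$ players can compute the secret from their shares, and no $k-1$ players obtain any information about the secret (unconditionally: the distribution of their shares does not depend on the secret). Its information rate is $\log_2|\mathcal{K}|/\log_2|\mathcal{S}|$. Repairing. A repairing protocol lets a player $P_\ell$ who lost their share recover exactly that share, without the dealer, with help from a set of other players, over secure pairwise channels. It has two phases. In the message exchange phase (possibly empty) each of the helping players, using their own share and private randomness, simultaneously sends at most one message to each other helping player. In the repairing phase the helping players each send a message to $P_\ell$ (depending on their share, randomness and the messages received), from which $P_\ell$ computes the lost share. Security: all players follow the protocol honestly,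 and for every coalition of $k-1$ players (which may or may not include $P_\ell$), the shares of the coalition together with all messages its members sent or received in the execution of the protocol give no information about the secret. A $(k,n)$-threshold scheme with such a secure protocol with repairing degree $d$ is a $(k,n,d)$-RTS (repairable threshold scheme). It has restricted repairability if for every player there exists a set of at most $d$ other players who can repair that player's share. The communication complexity of a repairing protocol is the sum of the bit-lengths of all messages transmitted divided by the bit-length of the secret (an element of a set of size $N$ has bit-length $\log_2 N$). *)

theory Defs
  imports
    "HOL-Probability.Product_PMF"
    "HOL-Number_Theory.Prime_Powers"
    "HOL-Algebra.Ring"
begin

text \<open>
  The blocks are a family indexed by \<open>{..<n}\<close>, so that repeated blocks are not excluded
  by the representation.
\<close>

definition design :: "'p set \<Rightarrow> (nat \<Rightarrow> 'p set) \<Rightarrow> nat \<Rightarrow> nat \<Rightarrow> bool" where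
  "design X B n d \<longleftrightarrow> finite X \<and> (\<forall>i<n. B i \<subseteq> X \<and> card (B i) = d)"

definition distribution_design ::
    "'p set \<Rightarrow> (nat \<Rightarrow> 'p set) \<Rightarrow> nat \<Rightarrow> nat \<Rightarrow> nat \<Rightarrow> int \<Rightarrow> int \<Rightarrow> bool" where
  "distribution_design X B n d k l1 l2 \<longleftrightarrow>
     design X B n d \<and> 2 \<le> k \<and> k \<le> n \<and> l2 - l1 \<ge> 1 \<and>
     (\<forall>I\<subseteq>{..<n}. card I = k \<longrightarrow> int (card (\<Union>i\<in>I. B i)) \<ge> l2) \<and>
     (\<forall>I\<subseteq>{..<n}. card I = k - 1 \<longrightarrow> int (card (\<Union>i\<in>I. B i)) \<le> l1)"

definition repairable :: "'p set \<Rightarrow> (nat \<Rightarrow> 'p set) \<Rightarrow> nat \<Rightarrow> bool" where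
  "repairable X B n \<longleftrightarrow> (\<forall>x\<in>X. card {i. i < n \<and> x \<in> B i} \<ge> 2)"

definition bit_length :: "'a set \<Rightarrow> real" where
  "bit_length A = log 2 (real (card A))"

text \<open>
  The players are the indices in \<open>{..<n}\<close>. The dealer maps a secret to a distribution on
  vectors of shares; these vectors are extensional outside \<open>{..<n}\<close>.
\<close>

record ('k, 's) scheme =
  secrets :: "'k set"
  shares :: "'s set"
  deal :: "'k \<Rightarrow> (nat \<Rightarrow> 's) pmf"

definition threshold_scheme :: "nat \<Rightarrow> nat \<Rightarrow> ('k, 's) scheme \<Rightarrow> bool" where
  "threshold_scheme k n T \<longleftrightarrow>
     2 \<le> k \<and> k \<le> n \<and>
     finite (secrets T) \<and> secrets T \<noteq> {} \<and> finite (shares T) \<and>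
     (\<forall>s\<in>secrets T. set_pmf (deal T s) \<subseteq> {..<n} \<rightarrow>\<^sub>E shares T) \<and>
     (\<forall>A\<subseteq>{..<n}. card A = k \<longrightarrow>
        (\<exists>reconstruct. \<forall>s\<in>secrets T. \<forall>v\<in>set_pmf (deal T s). reconstruct (restrict v A) = s)) \<and>
     (\<forall>A\<subseteq>{..<n}. card A = k - 1 \<longrightarrow>
        (\<forall>s\<in>secrets T. \<forall>s'\<in>secrets T.
           map_pmf (\<lambda>v. restrict v A) (deal T s) = map_pmf (\<lambda>v. restrict v A) (deal T s')))"

definition information_rate :: "('k, 's) scheme \<Rightarrow> real" where
  "information_rate T = bit_length (secrets T) / bit_length (shares T)"

text \<open>
  A protocol repairing the share of the player \<open>target\<close> with the help of the players in
  \<open>helpers\<close>. In the message exchange phase, exactly one message is sent from \<open>i\<close> to \<open>j\<close>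
  if \<open>(i, j) \<in> channels\<close>, and none otherwise; it lies in \<open>exchange_space i j\<close>. In the
  repairing phase, every helper \<open>i\<close> sends to \<open>target\<close> a message in \<open>repair_space i\<close>; the last
  argument of \<open>repair_msg i\<close> is the family of messages that \<open>i\<close> has received, indexed by
  their senders.
\<close>

record ('s, 'r, 'm) protocol =
  target :: nat
  helpers :: "nat set"
  randomness :: "nat \<Rightarrow> 'r pmf"
  channels :: "(nat \<times> nat) set"
  exchange_space :: "nat \<Rightarrow> nat \<Rightarrow> 'm set"
  exchange_msg :: "nat \<Rightarrow> nat \<Rightarrow> 's \<Rightarrow> 'r \<Rightarrow> 'm"
  repair_space :: "nat \<Rightarrow> 'm set"
  repair_msg :: "nat \<Rightarrow> 's \<Rightarrow> 'r \<Rightarrow> (nat \<Rightarrow> 'm) \<Rightarrow> 'm"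
  recover :: "(nat \<Rightarrow> 'm) \<Rightarrow> 's"

definition exchanged ::
    "('s, 'r, 'm) protocol \<Rightarrow> (nat \<Rightarrow> 's) \<Rightarrow> (nat \<Rightarrow> 'r) \<Rightarrow> nat \<times> nat \<Rightarrow> 'm" where
  "exchanged P v r = (\<lambda>(i, j)\<in>channels P. exchange_msg P i j (v i) (r i))"

definition sent_to_target ::
    "('s, 'r, 'm) protocol \<Rightarrow> (nat \<Rightarrow> 's) \<Rightarrow> (nat \<Rightarrow> 'r) \<Rightarrow> nat \<Rightarrow> 'm" where
  "sent_to_target P v r =
     (\<lambda>i\<in>helpers P. repair_msg P i (v i) (r i)
        (\<lambda>j\<in>{j. (j, i) \<in> channels P}. exchanged P v r (j, i)))"

text \<open>The random choices of the helpers are independent of each other and of the dealer's.\<close>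

definition execution ::
    "('k, 's) scheme \<Rightarrow> ('s, 'r, 'm) protocol \<Rightarrow> 'k \<Rightarrow> ((nat \<Rightarrow> 's) \<times> (nat \<Rightarrow> 'r)) pmf" where
  "execution T P s = pair_pmf (deal T s) (Pi_pmf (helpers P) undefined (randomness P))"

definition repairing_protocol ::
    "nat \<Rightarrow> ('k, 's) scheme \<Rightarrow> ('s, 'r, 'm) protocol \<Rightarrow> bool" where
  "repairing_protocol n T P \<longleftrightarrow>
     target P < n \<and> helpers P \<subseteq> {..<n} - {target P} \<and>
     channels P \<subseteq> {(i, j). i \<in> helpers P \<and> j \<in> helpers P \<and> i \<noteq> j} \<and>
     (\<forall>(i, j)\<in>channels P. finite (exchange_space P i j)) \<and>
     (\<forall>i\<in>helpers P. finite (repair_space P i)) \<and>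
     (\<forall>s\<in>secrets T. \<forall>(v, r)\<in>set_pmf (execution T P s).
        (\<forall>(i, j)\<in>channels P. exchanged P v r (i, j) \<in> exchange_space P i j) \<and>
        (\<forall>i\<in>helpers P. sent_to_target P v r i \<in> repair_space P i) \<and>
        recover P (sent_to_target P v r) = v (target P))"

definition view ::
    "('s, 'r, 'm) protocol \<Rightarrow> nat set \<Rightarrow> (nat \<Rightarrow> 's) \<Rightarrow> (nat \<Rightarrow> 'r) \<Rightarrow>
     (nat \<Rightarrow> 's) \<times> (nat \<times> nat \<Rightarrow> 'm) \<times> (nat \<Rightarrow> 'm)" where
  "view P A v r =
     (restrict v A,
      restrict (exchanged P v r) {(i, j) \<in> channels P. i \<in> A \<or> j \<in> A},
      restrict (sent_to_target P v r) {i \<in> helpers P. i \<in> A \<or> target P \<in> A})"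

definition secure_protocol ::
    "nat \<Rightarrow> nat \<Rightarrow> ('k, 's) scheme \<Rightarrow> ('s, 'r, 'm) protocol \<Rightarrow> bool" where
  "secure_protocol k n T P \<longleftrightarrow>
     (\<forall>A\<subseteq>{..<n}. card A = k - 1 \<longrightarrow>
        (\<forall>s\<in>secrets T. \<forall>s'\<in>secrets T.
           map_pmf (\<lambda>(v, r). view P A v r) (execution T P s) =
           map_pmf (\<lambda>(v, r). view P A v r) (execution T P s')))"

definition communication_complexity ::
    "('k, 's) scheme \<Rightarrow> ('s, 'r, 'm) protocol \<Rightarrow> real" where
  "communication_complexity T P =
     ((\<Sum>(i, j)\<in>channels P. bit_length (exchange_space P i j)) +
      (\<Sum>i\<in>helpers P. bit_length (repair_space P i))) / bit_length (secrets T)"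

text \<open>
  A player may have a repairing protocol for each of several sets of helpers, so a repairable
  threshold scheme comes with a set \<open>R\<close> of protocols. The repairing degree bounds the number
  of helpers.
\<close>

definition RTS ::
    "nat \<Rightarrow> nat \<Rightarrow> nat \<Rightarrow> ('k, 's) scheme \<Rightarrow> ('s, 'r, 'm) protocol set \<Rightarrow> bool" where
  "RTS k n d T R \<longleftrightarrow>
     threshold_scheme k n T \<and> R \<noteq> {} \<and>
     (\<forall>P\<in>R. repairing_protocol n T P \<and> card (helpers P) \<le> d \<and> secure_protocol k n T P)"

definition restricted_repairability ::
    "nat \<Rightarrow> nat \<Rightarrow> ('s, 'r, 'm) protocol set \<Rightarrow> bool" where
  "restricted_repairability n d R \<longleftrightarrow>
     (\<forall>l<n. \<exists>P\<in>R. target P = l \<and> card (helpers P) \<le> d)"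

definition tuples :: "'f set \<Rightarrow> nat \<Rightarrow> 'f list set" where
  "tuples S d = {v. length v = d \<and> set v \<subseteq> S}"

end

theory Submission
  imports "HOL-Algebra.Polynomial_Divisibility" Defs
begin

text \<open>
  The dealer shares a secret \<open>s\<close> of \<open>\<ell>\<^sub>2 - \<ell>\<^sub>1\<close> field elements by a ramp scheme:
  it forms the polynomial \<open>f = s + X\<^sup>e g\<close> with \<open>e = \<ell>\<^sub>2 - \<ell>\<^sub>1\<close>, where \<open>g\<close> is uniformly random of degree
  less than \<open>\<ell>\<^sub>1\<close>, and identifies the points of the design with nonzero field elements; a
  player's share consists of the values of \<open>f\<close> on the player's block. The values at \<open>\<ell>\<^sub>2\<close>
  points determine \<open>f\<close>, and, as the points are nonzero, those at \<open>\<ell>\<^sub>1\<close> points are uniformly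
  distributed for every \<open>s\<close>. To repair a share, every point of the lost block is assigned to
  one other player whose block contains it, and that player sends the value there. These
  messages are parts of the share of the sender and of the repaired share, so a coalition
  learns nothing beyond its own shares.
\<close>

text \<open>Frees the identifier \<open>X\<close>, which is the point set of the design below.\<close>

no_notation var ("X\<index>")

section \<open>Tuples, reconstruction functions and pairs of distributions\<close>

lemma finite_tuples: "finite S \<Longrightarrow> finite (tuples S n)"
  using finite_lists_length_eq[of S n] by (simp add: tuples_def conj_commute)

lemma card_tuples: "finite S \<Longrightarrow> card (tuples S n) = card S ^ n"
  using card_lists_length_eq[of S n] by (simp add: tuples_def conj_commute)

lemma tuples_nonempty: "S \<noteq> {} \<Longrightarrow> tuples S n \<noteq> {}"
  unfolding tuples_def by (auto intro: exI[of _ "replicate n x" for x])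

lemma bit_length_tuples:
  "finite S \<Longrightarrow> S \<noteq> {} \<Longrightarrow> bit_length (tuples S n) = real n * bit_length S"
  by (simp add: bit_length_def card_tuples log_nat_power card_gt_0_iff)

definition lookup :: "'a list \<Rightarrow> 'b list \<Rightarrow> 'a \<Rightarrow> 'b" where
  "lookup xs ys x = the (map_of (zip xs ys) x)"

lemma lookup_map: "x \<in> set xs \<Longrightarrow> lookup xs (map f xs) x = f x"
  by (simp add: lookup_def map_of_zip_map)

text \<open>Reduces reconstruction to uniqueness: once the observed data determine the secret,
  choice supplies the map \<open>r\<close>.\<close>

lemma ex_reconstruct:
  assumes "\<And>x x' y y'. x \<in> S \<Longrightarrow> x' \<in> S \<Longrightarrow> y \<in> D x \<Longrightarrow> y' \<in> D x' \<Longrightarrow> f y = f y' \<Longrightarrow> x = x'"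
  shows "\<exists>r. \<forall>x\<in>S. \<forall>y\<in>D x. r (f y) = x"
proof -
  have "(SOME x'. x' \<in> S \<and> (\<exists>y'\<in>D x'. f y = f y')) = x" if "x \<in> S" "y \<in> D x" for x y
    using that assms by (intro some_equality) blast+
  then show ?thesis by (intro exI[of _ "\<lambda>u. SOME x'. x' \<in> S \<and> (\<exists>y'\<in>D x'. u = f y')"] ballI)
qed

lemma map_fst_fun_pair_pmf: "map_pmf (\<lambda>(x, y). f x) (pair_pmf M N) = map_pmf f M"
proof -
  have "map_pmf (\<lambda>(x, y). f x) (pair_pmf M N) = map_pmf f (map_pmf fst (pair_pmf M N))"
    by (simp add: pmf.map_comp o_def case_prod_unfold)
  then show ?thesis by (simp add: map_fst_pair_pmf)
qed

section \<open>Evaluation of coefficient lists: unique interpolation and privacy\<close>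

context field
begin

text \<open>Entrywise subtraction keeps the length of a coefficient list, leading zeros included, so
  the degree bound given by that length stays visible.\<close>

lemma eval_map2_minus:
  assumes "length p = length q" "set p \<subseteq> carrier R" "set q \<subseteq> carrier R" "x \<in> carrier R"
  shows "eval (map2 (\<lambda>a b. a \<ominus> b) p q) x = eval p x \<ominus> eval q x"
  using assms
proof (induction p q rule: list_induct2)
  case (Cons a p b q)
  then have "eval p x \<in> carrier R" "eval q x \<in> carrier R"
    by (auto intro: eval_in_carrier)
  with Cons show ?case
    by (simp add: minus_eq l_distr l_minus minus_add a_ac)
qed (simp add: minus_eq)

text \<open>Roots can be counted only for proper polynomials, so leading zeros are stripped first. A
  nonempty \<open>normalize p\<close> would have at least \<open>card U\<close> distinct roots but
  degree less than \<open>length p\<close>.\<close>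

lemma eval_zero_imp_replicate_zero:
  assumes "set p \<subseteq> carrier R" "U \<subseteq> carrier R" "length p \<le> card U"
    and "\<And>x. x \<in> U \<Longrightarrow> eval p x = \<zero>"
  shows "p = replicate (length p) \<zero>"
proof (rule ccontr)
  let ?q = "normalize p"
  assume nz: "p \<noteq> replicate (length p) \<zero>"
  have "?q \<noteq> []"
  proof
    assume "?q = []"
    with normalize_def'(1)[of p] have "p = replicate (length p) \<zero>" by simp
    with nz show False by blast
  qed
  have q: "?q \<in> carrier (poly_ring R)"
    using normalize_gives_polynomial[OF assms(1)] by (simp add: univ_poly_carrier)
  have "is_root ?q x" if "x \<in> U" for x
    using that assms eval_normalize[OF assms(1), of x] \<open>?q \<noteq> []\<close> by (auto simp: is_root_def)
  then have "U \<subseteq> set_mset (roots ?q)"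
    using roots_mem_iff_is_root[OF q] by auto
  then have "card U \<le> card (set_mset (roots ?q))"
    by (intro card_mono) auto
  also have "\<dots> \<le> size (roots ?q)"
    by (metis mset_set_set_mset_msubset size_mset_mono size_mset_set)
  also have "\<dots> \<le> length ?q - 1"
    using q by (rule size_roots_le_degree)
  also have "\<dots> < length ?q" using \<open>?q \<noteq> []\<close> by simp
  also have "\<dots> \<le> length p" by (rule normalize_length_le)
  finally show False using assms(3) by simp
qed

text \<open>Serves both halves of the scheme: it makes the map from \<open>g\<close> to its values
  injective for privacy, and it recovers \<open>g @ s\<close> for reconstruction.\<close>

lemma eval_eq_imp_eq:
  assumes "length p = length q" "set p \<subseteq> carrier R" "set q \<subseteq> carrier R"
    and "U \<subseteq> carrier R" "length p \<le> card U"
    and "\<And>x. x \<in> U \<Longrightarrow> eval p x = eval q x"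
  shows "p = q"
proof -
  let ?d = "map2 (\<lambda>a b. a \<ominus> b) p q"
  have "?d = replicate (length ?d) \<zero>"
  proof (rule eval_zero_imp_replicate_zero)
    show "set ?d \<subseteq> carrier R"
      using assms(2,3) by (force dest: set_zip_leftD set_zip_rightD)
    show "eval ?d x = \<zero>" if "x \<in> U" for x
      using that assms by (subst eval_map2_minus) (auto simp: r_neg minus_eq eval_in_carrier)
  qed (use assms in auto)
  then have "?d ! i = replicate (length ?d) \<zero> ! i" for i by (rule arg_cong)
  then have z: "p ! i \<ominus> q ! i = \<zero>" if "i < length p" for i
    using that assms(1) by (metis (lifting) case_prod_conv length_map length_zip min.idem nth_map
      nth_replicate nth_zip)
  have "p ! i = q ! i" if "i < length p" for i
    using z[OF that] that assms(1-3) by (metis nth_mem r_right_minus_eq subsetD)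
  with assms(1) show ?thesis by (simp add: nth_equalityI)
qed

text \<open>Coefficient lists begin with the leading coefficient, so \<open>g @ s\<close> has the
  secret as its low-order part. Enlarge \<open>U\<close> to a set \<open>V\<close> of exactly
  \<open>t\<close> nonzero points: there the values of a random \<open>g @ s\<close> are uniform
  over all functions, a law free of \<open>s\<close>, and restricting to \<open>U\<close> keeps it
  so.\<close>

lemma ramp_privacy:
  assumes "finite (carrier R)" "U \<subseteq> carrier R - {\<zero>}" "card U \<le> t" "t < card (carrier R)"
    and "set s \<subseteq> carrier R" "set s' \<subseteq> carrier R"
  shows "map_pmf (\<lambda>g. restrict (eval (g @ s)) U) (pmf_of_set (tuples (carrier R) t)) =
    map_pmf (\<lambda>g. restrict (eval (g @ s')) U) (pmf_of_set (tuples (carrier R) t))"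
proof -
  obtain V where V: "U \<subseteq> V" "V \<subseteq> carrier R - {\<zero>}" "card V = t"
    using exists_subset_between[of U t "carrier R - {\<zero>}"] assms(1-4) by force
  have finV: "finite V" using V(2) assms(1) finite_subset by blast
  have uniform: "map_pmf (\<lambda>g. restrict (eval (g @ s)) V) (pmf_of_set (tuples (carrier R) t)) =
    pmf_of_set (V \<rightarrow>\<^sub>E carrier R)" if s: "set s \<subseteq> carrier R" for s
  proof (rule map_pmf_of_set_bij_betw)
    let ?f = "\<lambda>g. restrict (eval (g @ s)) V"
    have inj: "inj_on ?f (tuples (carrier R) t)"
    proof (rule inj_onI)
      fix g h assume g: "g \<in> tuples (carrier R) t" and h: "h \<in> tuples (carrier R) t"
        and eq: "?f g = ?f h"
      have "eval g x = eval h x" if "x \<in> V" for x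
      proof -
        have x: "x \<in> carrier R" "x \<noteq> \<zero>" using that V by auto
        have c: "eval g x \<in> carrier R" "eval h x \<in> carrier R" "eval s x \<in> carrier R"
          using g h s x by (auto simp: tuples_def intro!: eval_in_carrier)
        have "eval (g @ s) x = eval (h @ s) x"
          using eq that by (metis restrict_apply')
        then have "eval g x \<otimes> x [^] length s = eval h x \<otimes> x [^] length s"
          using g h s x c by (simp add: tuples_def eval_append)
        \<comment> \<open>Nonzero points enter here: at zero the value would depend on
          \<open>s\<close> alone when \<open>s\<close> is nonempty, and \<open>g\<close> could not
          be cancelled out.\<close>
        moreover have "x [^] length s \<noteq> \<zero>" using x by (induction s) (auto simp: integral_iff)
        ultimately show ?thesis using c x by (simp add: m_rcancel)
      qed
      then show "g = h"
        using g h V by (intro eval_eq_imp_eq[where U = V]) (auto simp: tuples_def)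
    qed
    have sub: "?f ` tuples (carrier R) t \<subseteq> V \<rightarrow>\<^sub>E carrier R"
      using s V(2) by (fastforce simp: tuples_def intro!: eval_in_carrier)
    \<comment> \<open>Both sides have q^t elements, q being the order of the field, so injectivity
      already gives a bijection.\<close>
    have "card (?f ` tuples (carrier R) t) = card (V \<rightarrow>\<^sub>E carrier R)"
      using inj V(3) finV assms(1) by (simp add: card_image card_tuples card_funcsetE)
    with sub have "?f ` tuples (carrier R) t = V \<rightarrow>\<^sub>E carrier R"
      using finV assms(1) by (intro card_subset_eq) (auto intro!: finite_PiE)
    with inj show "bij_betw ?f (tuples (carrier R) t) (V \<rightarrow>\<^sub>E carrier R)"
      by (simp add: bij_betw_def)
  qed (use assms(1) in \<open>auto intro!: tuples_nonempty finite_tuples\<close>)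
  have "map_pmf (\<lambda>g. restrict (eval (g @ s)) U) (pmf_of_set (tuples (carrier R) t)) =
    map_pmf (\<lambda>w. restrict w U) (pmf_of_set (V \<rightarrow>\<^sub>E carrier R))" if "set s \<subseteq> carrier R" for s
    unfolding uniform[OF that, symmetric]
    using V(1) by (simp add: pmf.map_comp o_def Int_absorb1)
  with assms(5,6) show ?thesis by simp
qed

end

section \<open>The scheme and repairing protocol attached to a family of blocks\<close>

lemma repairable_helper:
  assumes "repairable X B n" "B l \<subseteq> X" "x \<in> B l"
  shows "\<exists>i<n. i \<noteq> l \<and> x \<in> B i"
proof (rule ccontr)
  assume "\<not> ?thesis"
  then have "{i. i < n \<and> x \<in> B i} \<subseteq> {l}" by auto
  then have "card {i. i < n \<and> x \<in> B i} \<le> card {l}" by (intro card_mono) auto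
  moreover have "2 \<le> card {i. i < n \<and> x \<in> B i}"
    using assms by (auto simp: repairable_def)
  ultimately show False by simp
qed

text \<open>Blocks are given as lists \<open>bl i\<close>, because a share is a tuple and its
  entries need a fixed order of the points.\<close>

definition block_shares :: "nat \<Rightarrow> (nat \<Rightarrow> 'p list) \<Rightarrow> ('p \<Rightarrow> 'f) \<Rightarrow> nat \<Rightarrow> 'f list" where
  "block_shares n bl f = (\<lambda>i\<in>{..<n}. map f (bl i))"

definition block_scheme ::
    "('f, 'b) ring_scheme \<Rightarrow> nat \<Rightarrow> (nat \<Rightarrow> 'p list) \<Rightarrow> ('p \<Rightarrow> 'f) \<Rightarrow> nat \<Rightarrow> nat \<Rightarrow> nat \<Rightarrow>
      ('f list, 'f list) scheme" where
  "block_scheme F n bl pt d e t =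
     \<lparr>secrets = tuples (carrier F) e, shares = tuples (carrier F) d,
      deal = (\<lambda>s. map_pmf (\<lambda>g. block_shares n bl (\<lambda>x. ring.eval F (g @ s) (pt x)))
        (pmf_of_set (tuples (carrier F) t)))\<rparr>"

text \<open>Here \<open>h x\<close> is the player who supplies the value at the point
  \<open>x\<close> of the lost block. All points with the same helper travel in one message, in the
  order of \<open>bl l\<close>, which is also how \<open>recover\<close> decodes it.\<close>

definition block_protocol ::
    "'f set \<Rightarrow> (nat \<Rightarrow> 'p list) \<Rightarrow> ('p \<Rightarrow> nat) \<Rightarrow> nat \<Rightarrow> ('f list, nat, 'f list) protocol" where
  "block_protocol K bl h l =
     \<lparr>target = l, helpers = h ` set (bl l), randomness = (\<lambda>_. return_pmf 0), channels = {},
      exchange_space = (\<lambda>_ _. {}), exchange_msg = (\<lambda>_ _ _ _. []),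
      repair_space = (\<lambda>i. tuples K (card {x \<in> set (bl l). h x = i})),
      repair_msg = (\<lambda>i v _ _. map (lookup (bl i) v) (filter (\<lambda>x. h x = i) (bl l))),
      recover = (\<lambda>w. map (\<lambda>x. lookup (filter (\<lambda>y. h y = h x) (bl l)) (w (h x)) x) (bl l))\<rparr>"

lemma sent_block_protocol:
  assumes "\<And>x. x \<in> set (bl l) \<Longrightarrow> h x < n \<and> x \<in> set (bl (h x))" "i \<in> h ` set (bl l)"
  shows "sent_to_target (block_protocol K bl h l) (block_shares n bl f) r i =
    map f (filter (\<lambda>x. h x = i) (bl l))"
proof -
  have "i < n" using assms by blast
  moreover have "x \<in> set (bl i)" if "x \<in> set (bl l)" "h x = i" for x
    using assms(1)[OF that(1)] that(2) by simp
  ultimately show ?thesis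
    using assms(2) by (simp add: sent_to_target_def block_protocol_def block_shares_def lookup_map)
qed

lemma recover_block_protocol:
  assumes "\<And>x. x \<in> set (bl l) \<Longrightarrow> h x < n \<and> x \<in> set (bl (h x))" "l < n"
  shows "recover (block_protocol K bl h l)
    (sent_to_target (block_protocol K bl h l) (block_shares n bl f) r) = block_shares n bl f l"
proof -
  let ?w = "sent_to_target (block_protocol K bl h l) (block_shares n bl f) r"
  have "lookup (filter (\<lambda>y. h y = h x) (bl l)) (?w (h x)) x = f x" if "x \<in> set (bl l)" for x
    using that by (subst sent_block_protocol[OF assms(1)]) (simp_all add: lookup_map)
  then show ?thesis
    using assms(2) by (simp add: block_protocol_def block_shares_def)
qed

text \<open>Everything a coalition sees is a function of its own shares, and \<open>\<Phi>\<close>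
  depends on neither \<open>f\<close> nor \<open>r\<close>. Security of repairing thus reduces to
  privacy of the shares.\<close>

lemma view_block_protocol:
  fixes K :: "'f set" and bl :: "nat \<Rightarrow> 'p list"
  assumes h: "\<And>x. x \<in> set (bl l) \<Longrightarrow> h x < n \<and> x \<in> set (bl (h x))" and l: "l < n"
  obtains \<Phi> where "\<And>f r. view (block_protocol K bl h l) A (block_shares n bl f) r =
    \<Phi> (restrict (block_shares n bl f) A)"
proof
  let ?P = "block_protocol K bl h l"
  let ?M = "{i \<in> h ` set (bl l). i \<in> A \<or> l \<in> A}"
  fix f :: "'p \<Rightarrow> 'f" and r
  let ?v = "block_shares n bl f"
  \<comment> \<open>A message is visible only if its sender \<open>i\<close> or the target
    \<open>l\<close> is in \<open>A\<close>. In the first case it is read off the share of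
    \<open>i\<close>, in the second off the share of \<open>l\<close>, whose block contains all the
    points concerned.\<close>
  have "restrict (sent_to_target ?P ?v r) ?M =
      (\<lambda>i\<in>?M. map (\<lambda>x. if i \<in> A then lookup (bl i) (restrict ?v A i) x
        else lookup (bl l) (restrict ?v A l) x) (filter (\<lambda>x. h x = i) (bl l)))"
  proof (rule restrict_ext)
    fix i assume i: "i \<in> ?M"
    then have "sent_to_target ?P ?v r i = map f (filter (\<lambda>x. h x = i) (bl l))" and "i < n"
      using h by (auto intro: sent_block_protocol)
    moreover have "x \<in> set (bl i)" if "x \<in> set (bl l)" "h x = i" for x
      using h[OF that(1)] that(2) by simp
    ultimately show "sent_to_target ?P ?v r i = map (\<lambda>x. if i \<in> A then lookup (bl i) (restrict ?v A i) x
        else lookup (bl l) (restrict ?v A l) x) (filter (\<lambda>x. h x = i) (bl l))"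
      using i l by (auto simp: block_shares_def lookup_map)
  qed
  then show "view ?P A ?v r = (\<lambda>u. (u, \<lambda>_. undefined,
      \<lambda>i\<in>?M. map (\<lambda>x. if i \<in> A then lookup (bl i) (u i) x
        else lookup (bl l) (u l) x) (filter (\<lambda>x. h x = i) (bl l)))) (restrict ?v A)"
    by (simp add: view_def block_protocol_def restrict_def)
qed

text \<open>The fibres of \<open>h\<close> partition the block, so the message lengths add up to the
  length of one share.\<close>

lemma communication_block_protocol:
  assumes "finite K" "K \<noteq> {}" "distinct (bl l)"
  shows "communication_complexity T (block_protocol K bl h l) =
    real (length (bl l)) * bit_length K / bit_length (secrets T)"
proof -
  have "(\<Sum>i\<in>h ` set (bl l). real (card {x \<in> set (bl l). h x = i})) = real (card (set (bl l)))"
    using sum.image_gen[of "set (bl l)" "\<lambda>_. 1 :: real" h] by simp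
  then show ?thesis
    using assms by (simp add: communication_complexity_def block_protocol_def bit_length_tuples
      sum_distrib_right[symmetric] distinct_card)
qed

section \<open>Choice of the parameters and verification of the scheme\<close>

theorem theorem4p1:
  fixes X :: "'p set" and B :: "nat \<Rightarrow> 'p set"
    and k n d m Q :: nat and l1 l2 :: int
    and F :: "('f, 'b) ring_scheme"
  assumes "distribution_design X B n d k l1 l2"
    and "repairable X B n"
    and "card X = m"
    and "primepow Q"
    and "Q \<ge> m + 1"
    and "field F"
    and "card (carrier F) = Q"
  shows "\<exists>(T :: ('f list, 'f list) scheme) (R :: ('f list, nat, 'f list) protocol set).
    RTS k n d T R \<and>
    restricted_repairability n d R \<and>
    shares T = tuples (carrier F) d \<and>
    information_rate T = real_of_int (l2 - l1) / real d \<and>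
    (\<forall>P\<in>R. communication_complexity T P = real d / real_of_int (l2 - l1))"
proof -
  interpret field F by fact
  have Q: "Q \<ge> 2" using assms(4) primepow_gt_Suc_0 by fastforce
  \<comment> \<open>An infinite carrier would have \<open>card\<close> equal to 0.\<close>
  have finF: "finite (carrier F)" using assms(7) Q by (metis card.infinite not_numeral_le_zero)
  have bits: "bit_length (carrier F) > 0"
    using Q assms(7) by (simp add: bit_length_def)
  have finX: "finite X" and BX: "\<And>i. i < n \<Longrightarrow> B i \<subseteq> X" and cardB: "\<And>i. i < n \<Longrightarrow> card (B i) = d"
    and k: "2 \<le> k" "k \<le> n" and l12: "l2 - l1 \<ge> 1"
    and many: "\<And>I. I \<subseteq> {..<n} \<Longrightarrow> card I = k \<Longrightarrow> int (card (\<Union>i\<in>I. B i)) \<ge> l2"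
    and few: "\<And>I. I \<subseteq> {..<n} \<Longrightarrow> card I = k - 1 \<Longrightarrow> int (card (\<Union>i\<in>I. B i)) \<le> l1"
    using assms(1) by (auto simp: distribution_design_def design_def)
  have finB: "finite (B i)" if "i < n" for i using BX[OF that] finX finite_subset by blast
  have "int (card (\<Union>i\<in>{..<k-1}. B i)) \<le> l1" using k by (intro few) auto
  then have l1: "0 \<le> l1" by linarith
  have "l2 \<le> int (card (\<Union>i\<in>{..<k}. B i))" using k by (intro many) auto
  also have "card (\<Union>i\<in>{..<k}. B i) \<le> m"
    unfolding assms(3)[symmetric] using k BX finX by (intro card_mono UN_least) auto
  finally have l2: "l2 \<le> int m" by simp
  \<comment> \<open>Since 0 <= l1 < l2 <= m < Q, the conversions by \<open>nat\<close> lose nothing,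
    and \<open>t < Q\<close> leaves \<open>t\<close> nonzero points for
    \<open>ramp_privacy\<close>.\<close>
  define t e where "t = nat l1" and "e = nat (l2 - l1)"
  have te: "int t = l1" "int (t + e) = l2" "real e = real_of_int (l2 - l1)" "t < Q" "e > 0"
    using l1 l12 l2 assms(5) by (auto simp: t_def e_def)
  obtain pt where pt: "inj_on pt X" "pt ` X \<subseteq> carrier F - {\<zero>\<^bsub>F\<^esub>}"
    using card_le_inj[of X "carrier F - {\<zero>\<^bsub>F\<^esub>}"] finF finX assms(3,5,7) by force
  have "\<exists>bl. \<forall>i<n. set (bl i) = B i \<and> distinct (bl i)"
    using finite_distinct_list[OF finB] by metis
  then obtain bl where bl: "\<And>i. i < n \<Longrightarrow> set (bl i) = B i" "\<And>i. i < n \<Longrightarrow> distinct (bl i)"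
    by blast
  have len: "length (bl i) = d" if "i < n" for i
    using distinct_card[OF bl(2)[OF that]] bl(1)[OF that] cardB[OF that] by simp
  have "\<exists>h. \<forall>l<n. \<forall>x\<in>B l. h l x < n \<and> h l x \<noteq> l \<and> x \<in> B (h l x)"
    using repairable_helper[OF assms(2) BX] by metis
  then obtain h where h: "\<And>l x. l < n \<Longrightarrow> x \<in> B l \<Longrightarrow> h l x < n \<and> h l x \<noteq> l \<and> x \<in> B (h l x)"
    by blast
  then have hbl: "h l x < n \<and> x \<in> set (bl (h l x))" if "l < n" "x \<in> set (bl l)" for l x
    using that bl by auto
  let ?T = "block_scheme F n bl pt d e t"
  let ?P = "\<lambda>l. block_protocol (carrier F) bl (h l) l"
  let ?f = "\<lambda>s g x. eval (g @ s) (pt x)"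
  have K: "carrier F \<noteq> {}" by blast
  have secr: "secrets ?T = tuples (carrier F) e" and shar: "shares ?T = tuples (carrier F) d"
    and deal: "deal ?T s = map_pmf (\<lambda>g. block_shares n bl (?f s g))
      (pmf_of_set (tuples (carrier F) t))" for s
    by (simp_all add: block_scheme_def)
  have dealt: "\<exists>g\<in>tuples (carrier F) t. v = block_shares n bl (?f s g)"
    if "v \<in> set_pmf (deal ?T s)" for v s
    using that finite_tuples[OF finF] tuples_nonempty[OF K] by (auto simp: deal)
  have f_in: "?f s g x \<in> carrier F"
    if "s \<in> tuples (carrier F) e" "g \<in> tuples (carrier F) t" "x \<in> X" for s g x
    using that pt(2) by (intro eval_in_carrier) (auto simp: tuples_def)
  have unionX: "(\<Union>i\<in>A. B i) \<subseteq> X" if "A \<subseteq> {..<n}" for A using that BX by blast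
  have hiding: "map_pmf (\<lambda>v. restrict v A) (deal ?T s) = map_pmf (\<lambda>v. restrict v A) (deal ?T s')"
    if A: "A \<subseteq> {..<n}" "card A = k - 1" and s: "s \<in> secrets ?T" "s' \<in> secrets ?T" for A s s'
  proof -
    let ?U = "pt ` (\<Union>i\<in>A. B i)"
    \<comment> \<open>The shares of \<open>A\<close> are a fixed function of the values of the
      polynomial on \<open>?U\<close>, so privacy passes from those values to the shares.\<close>
    have factor: "map_pmf (\<lambda>v. restrict v A) (deal ?T s) =
        map_pmf (\<lambda>w. \<lambda>i\<in>A. map (\<lambda>x. w (pt x)) (bl i))
          (map_pmf (\<lambda>g. restrict (eval (g @ s)) ?U) (pmf_of_set (tuples (carrier F) t)))" for s
      unfolding deal pmf.map_comp o_def
    proof (intro map_pmf_cong refl restrict_ext)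
      fix g i assume "i \<in> A"
      with A bl(1) show "block_shares n bl (?f s g) i =
          map (\<lambda>x. restrict (eval (g @ s)) ?U (pt x)) (bl i)"
        by (auto simp: block_shares_def)
    qed
    have "card ?U \<le> t"
      using card_image_le[of "\<Union>i\<in>A. B i" pt] few[OF A] te(1) unionX[OF A(1)] finX
      by (meson finite_subset le_trans of_nat_le_iff)
    moreover have "?U \<subseteq> carrier F - {\<zero>\<^bsub>F\<^esub>}"
      using unionX[OF A(1)] pt(2) by blast
    ultimately show ?thesis
      unfolding factor using s te(4) finF assms(7)
      by (subst ramp_privacy[of ?U t s s']) (auto simp: secr tuples_def)
  qed
  have reconstructs: "\<exists>rec. \<forall>s\<in>secrets ?T. \<forall>v\<in>set_pmf (deal ?T s). rec (restrict v A) = s"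
    if A: "A \<subseteq> {..<n}" "card A = k" for A
  proof -
    have unique: "s = s'" if s: "s \<in> secrets ?T" "s' \<in> secrets ?T"
      and v: "v \<in> set_pmf (deal ?T s)" "v' \<in> set_pmf (deal ?T s')"
      and eq: "restrict v A = restrict v' A" for s s' v v'
    proof -
      obtain g g' where g: "g \<in> tuples (carrier F) t" "v = block_shares n bl (?f s g)"
        and g': "g' \<in> tuples (carrier F) t" "v' = block_shares n bl (?f s' g')"
        using dealt[OF v(1)] dealt[OF v(2)] by blast
      let ?U = "pt ` (\<Union>i\<in>A. B i)"
      \<comment> \<open>Injectivity of \<open>pt\<close> ensures that merging points does not spoil
        the lower bound \<open>l2\<close> on the number of evaluation points.\<close>
      have "card ?U = card (\<Union>i\<in>A. B i)"
        using pt(1) unionX[OF A(1)] by (intro card_image) (rule inj_on_subset)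
      then have cU: "t + e \<le> card ?U" using many[OF A] te(2) by linarith
      have "?f s g x = ?f s' g' x" if "i \<in> A" "x \<in> B i" for i x
      proof -
        have "i < n" using that A by blast
        moreover have "v i = v' i" using eq that(1) by (metis restrict_apply')
        ultimately show ?thesis using that(2) bl(1) g(2) g'(2) by (auto simp: block_shares_def)
      qed
      moreover have "?U \<subseteq> carrier F" using unionX[OF A(1)] pt(2) by blast
      \<comment> \<open>Both lists have length \<open>t + e\<close>, at most the number of points in
        \<open>?U\<close>; equality of the lists then splits at position \<open>t\<close> to give
        the secrets.\<close>
      ultimately have "g @ s = g' @ s'"
        using g(1) g'(1) s cU
        by (intro eval_eq_imp_eq[where U = ?U]) (auto simp: secr tuples_def)
      then show ?thesis using g(1) g'(1) by (simp add: tuples_def)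
    qed
    show ?thesis by (rule ex_reconstruct) (rule unique)
  qed
  have threshold: "threshold_scheme k n ?T"
    unfolding threshold_scheme_def
  proof (intro conjI ballI allI impI)
    show "set_pmf (deal ?T s) \<subseteq> {..<n} \<rightarrow>\<^sub>E shares ?T" if "s \<in> secrets ?T" for s
    proof
      fix v assume "v \<in> set_pmf (deal ?T s)"
      with dealt obtain g where g: "g \<in> tuples (carrier F) t" "v = block_shares n bl (?f s g)"
        by blast
      then show "v \<in> {..<n} \<rightarrow>\<^sub>E shares ?T"
        using that f_in[OF _ g(1)] len bl(1) BX
        by (auto simp: block_shares_def shar secr tuples_def subset_iff)
    qed
    show "finite (secrets ?T)" "secrets ?T \<noteq> {}" "finite (shares ?T)"
      by (simp_all only: secr shar finite_tuples[OF finF] tuples_nonempty[OF K] not_False_eq_True)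
  qed (use k reconstructs in \<open>blast intro: hiding\<close>)+
  have protocol: "repairing_protocol n ?T (?P l)" if l: "l < n" for l
  proof -
    note h_l = hbl[OF l]
    have "sent_to_target (?P l) (block_shares n bl (?f s g)) r i \<in> repair_space (?P l) i"
      if "s \<in> tuples (carrier F) e" "g \<in> tuples (carrier F) t" "i \<in> h l ` set (bl l)" for s g r i
    proof -
      have "length (filter (\<lambda>x. h l x = i) (bl l)) = card {x \<in> set (bl l). h l x = i}"
        using distinct_card[of "filter (\<lambda>x. h l x = i) (bl l)"] bl(2)[OF l] by simp
      moreover have "?f s g x \<in> carrier F" if "x \<in> set (bl l)" for x
        using that f_in \<open>s \<in> _\<close> \<open>g \<in> _\<close> bl(1)[OF l] BX[OF l] by blast
      ultimately have "map (?f s g) (filter (\<lambda>x. h l x = i) (bl l)) \<in> repair_space (?P l) i"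
        by (auto simp: block_protocol_def tuples_def)
      then show ?thesis
        using sent_block_protocol[of bl l "h l" n i "carrier F" "?f s g" r] h_l that(3) by simp
    qed
    moreover have "recover (?P l) (sent_to_target (?P l) (block_shares n bl f) r) =
        block_shares n bl f l" for f :: "'p \<Rightarrow> 'f" and r
      using recover_block_protocol[of bl l "h l" n] h_l l by blast
    moreover have "target (?P l) = l" "helpers (?P l) = h l ` set (bl l)" "channels (?P l) = {}"
      by (simp_all add: block_protocol_def)
    moreover have "finite (repair_space (?P l) i)" for i
      by (simp add: block_protocol_def finite_tuples finF)
    moreover have "h l ` set (bl l) \<subseteq> {..<n} - {l}" using h l bl(1) by auto
    ultimately show ?thesis
      using l by (auto simp: repairing_protocol_def execution_def secr dest!: dealt)
  qed
  have secure: "secure_protocol k n ?T (?P l)" if l: "l < n" for l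
    unfolding secure_protocol_def
  proof (intro allI impI ballI)
    fix A s s' assume A: "A \<subseteq> {..<n}" "card A = k - 1" and s: "s \<in> secrets ?T" "s' \<in> secrets ?T"
    obtain \<Phi> where \<Phi>: "\<And>f r. view (?P l) A (block_shares n bl f) r =
        \<Phi> (restrict (block_shares n bl f) A)"
      using view_block_protocol[of bl l "h l" n "carrier F" A] hbl l by blast
    \<comment> \<open>The helpers' randomness is independent of the deal and does not affect the
      view, so it projects away.\<close>
    have "map_pmf (\<lambda>(v, r). view (?P l) A v r) (execution ?T (?P l) s) =
        map_pmf \<Phi> (map_pmf (\<lambda>v. restrict v A) (deal ?T s))" for s
    proof -
      have "map_pmf (\<lambda>(v, r). view (?P l) A v r) (execution ?T (?P l) s) =
          map_pmf (\<lambda>(v, r). \<Phi> (restrict v A)) (execution ?T (?P l) s)"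
        by (intro map_pmf_cong refl) (auto simp: execution_def \<Phi> dest!: dealt)
      then show ?thesis
        by (simp add: execution_def map_fst_fun_pair_pmf pmf.map_comp o_def)
    qed
    with hiding[OF A s] show "map_pmf (\<lambda>(v, r). view (?P l) A v r) (execution ?T (?P l) s) =
        map_pmf (\<lambda>(v, r). view (?P l) A v r) (execution ?T (?P l) s')" by simp
  qed
  have degree: "card (helpers (?P l)) \<le> d" if "l < n" for l
    using card_image_le[OF finite_set, of "h l" "bl l"] that bl(1) cardB
    by (simp add: block_protocol_def del: finite_set)
  have "RTS k n d ?T (?P ` {..<n})"
    using threshold protocol secure degree k by (auto simp: RTS_def lessThan_empty_iff)
  moreover have "restricted_repairability n d (?P ` {..<n})"
    unfolding restricted_repairability_def
  proof (intro allI impI)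
    fix l assume "l < n"
    moreover have "target (?P l) = l" by (simp add: block_protocol_def)
    ultimately show "\<exists>P\<in>?P ` {..<n}. target P = l \<and> card (helpers P) \<le> d"
      using degree by blast
  qed
  \<comment> \<open>Both quotients are ratios of tuple lengths; the common factor log Q cancels
    because \<open>bits\<close> makes it positive.\<close>
  moreover have "information_rate ?T = real_of_int (l2 - l1) / real d"
    using bits te(3) finF K by (simp add: information_rate_def secr shar bit_length_tuples)
  moreover have "communication_complexity ?T (?P l) = real d / real_of_int (l2 - l1)" if "l < n" for l
    using communication_block_protocol[where bl = bl and T = ?T, OF finF K bl(2)[OF that]] bits te(3) finF K len[OF that]
    by (simp add: secr bit_length_tuples)
  ultimately show ?thesis using shar by blast
qed

end
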